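(* Let $a\in A\subseteq \mathbb{R}^m$, let $f\colon A \to \mathbb{R}^n$, let $V\subseteq \mathbb{R}^m$ be a linear subspace of $\mathbb{R}^m$ and let $L\in \mathcal{L}(V,\mathbb{R}^n)$. The following statements are equivalent: (i) the linear map $L$ is a tangential derivative of $f$ at $a$ with respect to $V$; (ii) for each map $\psi \colon U\subseteq\mathbb{R}^m \to \mathbb{R}^m$ such that $U\subseteq A$ is open, $a\in U$ and $\psi\colon U \to \psi(U)$ is a diffeomorphism, $L \circ D\psi^{-1}(\psi(a)) \in \mathcal{L}(D\psi(a)[V], \mathbb{R}^n)$ is a directional derivative of $f \circ \psi^{-1}$ at $\psi(a)$ with respect to $D\psi(a)[V]$; (iii) for each path $\gamma \in C^1((-1,1),\mathbb{R}^m)$ such that $\gamma(0) = a$ and $\gamma'(0)\in V\setminus \{0\}$, the composite function $f\circ \gamma$ is differentiable at $0$ and $(f\circ \gamma)'(0) = L[\gamma'(0)]$; (iv) for each $v\in V \setminus \{0\}$, $$\lim_{\substack{x\to a\\ \frac{x-a}{\lVert x-a\rVert} \to v }} \frac{f(x)-f(a) - \lVert x-a\rVert L[v]}{\lVert x-a\rVert} = 0.$$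
   Context: $\mathcal{L}(V,\mathbb{R}^n)$ is the space of linear maps from $V$ to $\mathbb{R}^n$. Let $A\subseteq\mathbb{R}^m$, $a\in A$, $f\colon A\to\mathbb{R}^n$, let $V\subseteq\mathbb{R}^m$ be a linear subspace and $L\in\mathcal{L}(V,\mathbb{R}^n)$. Directional derivative: $L$ is a directional derivative of $f$ at $a$ with respect to $V$ if for every $\varepsilon>0$ there exists $\delta>0$ such that if $x\in A\cap(V+a)$ and $\lVert x-a\rVert\le\delta$, then $\lVert f(x)-f(a)-L[x-a]\rVert\le\varepsilon\lVert x-a\rVert$. Tangential derivative: $L$ is a tangential derivative of $f$ at $a$ with respect to $V$ if for every $\varepsilon>0$ there exist $\delta>0$ and $\theta>0$ such that if $x\in A$, $v\in V$, $\lVert x-a\rVert\le\delta$ and $\lVert x-a-v\rVert\le\theta\lVert x-a\rVert$, then $\lVert f(x)-f(a)-L[v]\rVert\le\varepsilon\lVert x-a\rVert$. The limit in (iv) means: for every $\varepsilon>0$ there exist $\delta>0$ and $\theta>0$ such that if $x\in A\setminus\{a\}$, $\lVert x-a\rVert\le\delta$ and $\bigl\lVert\frac{x-a}{\lVert x-a\rVert}-v\bigr\rVert\le\theta$, then $\lVert f(x)-f(a)-\lVert x-a\rVert L[v]\rVert\le\varepsilon\lVert x-a\rVert$.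
   Formalization: In (ii), U is open relative to A and ψ is the restriction of a C¹ diffeomorphism of an open set W ⊇ U: with U open in ℝ^m, (ii) is vacuous unless a is interior to A. In (iii), the derivative of f∘γ at 0 is taken within γ⁻¹(A). *)

theory Defs
  imports "HOL-Analysis.Analysis"
begin

text \<open>
  Functions defined on a subset \<open>A\<close> of \<open>\<real>\<^sup>m\<close> are rendered as total functions together with the
  set \<open>A\<close>; every notion below looks at the function on \<open>A\<close> only. Likewise a linear map on a
  subspace \<open>V\<close> is a total function of which only the values on \<open>V\<close> matter.
\<close>

definition linear_maps :: "'a::real_vector set \<Rightarrow> ('a \<Rightarrow> 'b::real_vector) set" where
  "linear_maps V =
     {L. (\<forall>x\<in>V. \<forall>y\<in>V. L (x + y) = L x + L y) \<and> (\<forall>c. \<forall>x\<in>V. L (c *\<^sub>R x) = c *\<^sub>R L x)}"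

definition directional_derivative ::
  "('a::euclidean_space \<Rightarrow> 'b::euclidean_space) \<Rightarrow> 'a set \<Rightarrow> 'a \<Rightarrow> 'a set \<Rightarrow> ('a \<Rightarrow> 'b) \<Rightarrow> bool" where
  "directional_derivative f A a V L \<longleftrightarrow>
     L \<in> linear_maps V \<and>
     (\<forall>\<epsilon>>0. \<exists>\<delta>>0. \<forall>x \<in> A \<inter> (\<lambda>v. v + a) ` V.
        norm (x - a) \<le> \<delta> \<longrightarrow> norm (f x - f a - L (x - a)) \<le> \<epsilon> * norm (x - a))"

definition tangential_derivative ::
  "('a::euclidean_space \<Rightarrow> 'b::euclidean_space) \<Rightarrow> 'a set \<Rightarrow> 'a \<Rightarrow> 'a set \<Rightarrow> ('a \<Rightarrow> 'b) \<Rightarrow> bool" where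
  "tangential_derivative f A a V L \<longleftrightarrow>
     L \<in> linear_maps V \<and>
     (\<forall>\<epsilon>>0. \<exists>\<delta>>0. \<exists>\<theta>>0. \<forall>x\<in>A. \<forall>v\<in>V.
        norm (x - a) \<le> \<delta> \<and> norm (x - a - v) \<le> \<theta> * norm (x - a) \<longrightarrow>
        norm (f x - f a - L v) \<le> \<epsilon> * norm (x - a))"

definition continuously_differentiable_on ::
  "('a::euclidean_space \<Rightarrow> 'b::euclidean_space) \<Rightarrow> 'a set \<Rightarrow> bool" where
  "continuously_differentiable_on f S \<longleftrightarrow>
     (\<exists>f' :: 'a \<Rightarrow> 'a \<Rightarrow>\<^sub>L 'b.
        (\<forall>x\<in>S. (f has_derivative blinfun_apply (f' x)) (at x)) \<and> continuous_on S f')"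

text \<open>
  Diffeomorphisms are of class \<open>C\<^sup>1\<close>, the same class as the paths in the theorem. (With smooth
  diffeomorphisms the theorem fails: the graph of \<open>\<bar>t\<bar> powr (3/2)\<close> is tangent to the
  horizontal axis at \<open>0\<close>, but no regular \<open>C\<^sup>2\<close> curve tangent to that axis at \<open>0\<close> meets it at other points
  arbitrarily close to \<open>0\<close>.)
\<close>

definition diffeomorphism_on ::
  "'a::euclidean_space set \<Rightarrow> ('a \<Rightarrow> 'a) \<Rightarrow> bool" where
  "diffeomorphism_on W \<psi> \<longleftrightarrow>
     open W \<and> open (\<psi> ` W) \<and> inj_on \<psi> W \<and>
     continuously_differentiable_on \<psi> W \<and>
     continuously_differentiable_on (inv_into W \<psi>) (\<psi> ` W)"

text \<open>
  The transported map \<open>L \<circ> D\<psi>\<^sup>-\<^sup>1(\<psi>(a))\<close> is a directional derivative of \<open>f \<circ> \<psi>\<^sup>-\<^sup>1\<close>, defined on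
  \<open>\<psi>(U)\<close>, at \<open>\<psi>(a)\<close> with respect to \<open>D\<psi>(a)[V]\<close>; here \<open>W\<close> is an open set containing \<open>U\<close> on
  which \<open>\<psi>\<close> is a diffeomorphism, so that both derivatives make sense.
\<close>

definition transported_directional_derivative ::
  "('a::euclidean_space \<Rightarrow> 'b::euclidean_space) \<Rightarrow> 'a \<Rightarrow> 'a set \<Rightarrow> ('a \<Rightarrow> 'b)
     \<Rightarrow> 'a set \<Rightarrow> 'a set \<Rightarrow> ('a \<Rightarrow> 'a) \<Rightarrow> bool" where
  "transported_directional_derivative f a V L W U \<psi> \<longleftrightarrow>
     directional_derivative (f \<circ> inv_into W \<psi>) (\<psi> ` U) (\<psi> a)
       (frechet_derivative \<psi> (at a) ` V)
       (L \<circ> frechet_derivative (inv_into W \<psi>) (at (\<psi> a)))"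

lemma directional_derivative_local:
  assumes d: "directional_derivative g B b V L" and "r > 0" and sub: "C \<inter> cball b r \<subseteq> B"
    and eq: "\<And>x. x \<in> C \<inter> cball b r \<Longrightarrow> h x = g x" and eqb: "h b = g b"
  shows "directional_derivative h C b V L"
  unfolding directional_derivative_def
proof (intro conjI allI impI)
  show "L \<in> linear_maps V" using d by (simp add: directional_derivative_def)
  fix \<epsilon> :: real assume "\<epsilon> > 0"
  then obtain \<delta> where "\<delta> > 0" and \<delta>: "\<forall>x \<in> B \<inter> (\<lambda>v. v + b) ` V.
        norm (x - b) \<le> \<delta> \<longrightarrow> norm (g x - g b - L (x - b)) \<le> \<epsilon> * norm (x - b)"
    using d by (auto simp: directional_derivative_def)
  have "norm (h x - h b - L (x - b)) \<le> \<epsilon> * norm (x - b)"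
    if "x \<in> C \<inter> (\<lambda>v. v + b) ` V" "norm (x - b) \<le> min \<delta> r" for x
  proof -
    have "x \<in> C \<inter> cball b r" using that by (auto simp: dist_norm norm_minus_commute)
    then have "x \<in> B" "h x = g x" using sub eq by auto
    then show ?thesis using \<delta> that eqb by auto
  qed
  then show "\<exists>\<delta>>0. \<forall>x \<in> C \<inter> (\<lambda>v. v + b) ` V.
        norm (x - b) \<le> \<delta> \<longrightarrow> norm (h x - h b - L (x - b)) \<le> \<epsilon> * norm (x - b)"
    using \<open>\<delta> > 0\<close> \<open>r > 0\<close> by (intro exI[of _ "min \<delta> r"]) auto
qed

lemma inv_into_restrict:
  assumes "inj_on \<psi> W" "N \<subseteq> W" "y \<in> \<psi> ` N"
  shows "inv_into N \<psi> y = inv_into W \<psi> y"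
  using assms by (metis imageE inj_on_subset inv_into_f_f subsetD)

lemma diffeomorphism_on_restrict:
  assumes \<psi>: "diffeomorphism_on W \<psi>" and N: "open N" "N \<subseteq> W"
  shows "diffeomorphism_on N \<psi>"
proof -
  note D = \<psi>[unfolded diffeomorphism_on_def]
  have inj: "inj_on \<psi> W" using D by blast
  have "\<psi> ` N = \<psi> ` W \<inter> inv_into W \<psi> -` N"
    using inj N by (auto simp: inv_into_f_f subset_eq)
  moreover from D obtain g' where
    g': "\<forall>y\<in>\<psi> ` W. (inv_into W \<psi> has_derivative blinfun_apply (g' y)) (at y)"
        "continuous_on (\<psi> ` W) g'"
    unfolding continuously_differentiable_on_def by blast
  moreover have "continuous_on (\<psi> ` W) (inv_into W \<psi>)"
    using g'(1) by (meson continuous_at_imp_continuous_on has_derivative_continuous)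
  ultimately have op: "open (\<psi> ` N)"
    using D N by (metis continuous_open_preimage)
  have "(inv_into N \<psi> has_derivative blinfun_apply (g' y)) (at y)" if "y \<in> \<psi> ` N" for y
    by (rule has_derivative_transform_within_open[OF _ op that])
      (use g'(1) that N inv_into_restrict[OF inj N(2)] in auto)
  then have "continuously_differentiable_on (inv_into N \<psi>) (\<psi> ` N)"
    unfolding continuously_differentiable_on_def
    using continuous_on_subset[OF g'(2) image_mono[OF N(2)]] by blast
  moreover have "continuously_differentiable_on \<psi> N"
    using D N unfolding continuously_differentiable_on_def
    by (meson continuous_on_subset subsetD)
  ultimately show ?thesis
    using N op inj inj_on_subset unfolding diffeomorphism_on_def by blast
qed

text \<open>
  In the theorem, \<open>U \<subseteq> A\<close> is open relative to \<open>A\<close>, and \<open>\<psi>\<close> is a diffeomorphism on an open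
  subset \<open>W\<close> of \<open>\<real>\<^sup>m\<close> containing \<open>U\<close>. When \<open>A\<close> is a neighbourhood of \<open>a\<close> this is the same as
  asking that \<open>U\<close> is open in \<open>\<real>\<^sup>m\<close>:
\<close>

lemma relatively_open_iff_open:
  assumes "a \<in> interior A"
  shows
    "(\<forall>W U \<psi>. diffeomorphism_on W \<psi> \<and> U \<subseteq> W \<and> U \<subseteq> A \<and> openin (top_of_set A) U \<and> a \<in> U \<longrightarrow>
        transported_directional_derivative f a V L W U \<psi>) \<longleftrightarrow>
     (\<forall>U \<psi>. diffeomorphism_on U \<psi> \<and> U \<subseteq> A \<and> open U \<and> a \<in> U \<longrightarrow>
        transported_directional_derivative f a V L U U \<psi>)" (is "?rel \<longleftrightarrow> ?abs")
proof
  assume ?rel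
  show ?abs
  proof (intro allI impI)
    fix U \<psi> assume H: "diffeomorphism_on U \<psi> \<and> U \<subseteq> A \<and> open U \<and> a \<in> U"
    then have "openin (top_of_set A) U" by (auto simp: openin_open)
    with H show "transported_directional_derivative f a V L U U \<psi>" using \<open>?rel\<close> by blast
  qed
next
  assume abs: ?abs
  show ?rel
  proof (intro allI impI)
    fix W U \<psi>
    assume H: "diffeomorphism_on W \<psi> \<and> U \<subseteq> W \<and> U \<subseteq> A \<and> openin (top_of_set A) U \<and> a \<in> U"
    then obtain T where T: "open T" "U = A \<inter> T" by (auto simp: openin_open)
    define N where "N = interior A \<inter> T \<inter> W"
    have inj: "inj_on \<psi> W" using H by (simp add: diffeomorphism_on_def)
    have N: "open N" "N \<subseteq> W" "N \<subseteq> U" "a \<in> N"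
      using H T assms interior_subset[of A] by (auto simp: N_def diffeomorphism_on_def)
    have dN: "diffeomorphism_on N \<psi>" using H N diffeomorphism_on_restrict by blast
    then have op: "open (\<psi> ` N)" by (simp add: diffeomorphism_on_def)
    then obtain r where r: "r > 0" "cball (\<psi> a) r \<subseteq> \<psi> ` N"
      using N by (meson imageI open_contains_cball)
    have eq: "inv_into N \<psi> y = inv_into W \<psi> y" if "y \<in> \<psi> ` N" for y
      using inv_into_restrict[OF inj N(2) that] .
    have a: "\<psi> a \<in> \<psi> ` N" using N by blast
    have "(inv_into N \<psi> has_derivative D) (at (\<psi> a)) \<longleftrightarrow>
          (inv_into W \<psi> has_derivative D) (at (\<psi> a))" for D
      using has_derivative_transform_within_open[OF _ op a] eq by (metis (no_types, lifting))
    then have "frechet_derivative (inv_into N \<psi>) (at (\<psi> a)) =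
               frechet_derivative (inv_into W \<psi>) (at (\<psi> a))"
      by (simp add: frechet_derivative_def)
    moreover have "transported_directional_derivative f a V L N N \<psi>"
      using abs dN N T by blast
    ultimately have "directional_derivative (f \<circ> inv_into N \<psi>) (\<psi> ` N) (\<psi> a)
       (frechet_derivative \<psi> (at a) ` V) (L \<circ> frechet_derivative (inv_into W \<psi>) (at (\<psi> a)))"
      by (simp add: transported_directional_derivative_def)
    then show "transported_directional_derivative f a V L W U \<psi>"
      unfolding transported_directional_derivative_def
      by (rule directional_derivative_local[OF _ r(1)]) (use r(2) eq a in auto)
  qed
qed

end

theory Submission
  imports Defs
begin

text \<open>
  A tangential derivative is compatible with precomposition by any map whose derivative at the base
  point takes values in \<open>V\<close>, and this yields both diffeomorphisms and paths. Conversely, if the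
  directional limit fails for a unit vector \<open>v\<close>, it fails along points
  \<open>x\<^sub>k = a + t\<^sub>k v + s\<^sub>k\<close> with \<open>t\<^sub>k\<close> decreasing geometrically, \<open>s\<^sub>k\<close> orthogonal to \<open>v\<close> and
  \<open>\<parallel>s\<^sub>k\<parallel> \<le> t\<^sub>k / 2\<^sup>k\<close>. A sum of disjointly supported bumps is a \<open>C\<^sup>1\<close> map \<open>r\<close>, orthogonal to \<open>v\<close>,
  with \<open>r(0) = r'(0) = 0\<close> and \<open>r(t\<^sub>k) = s\<^sub>k\<close>. The path \<open>t \<mapsto> a + t v + r(t)\<close> contradicts the path
  condition. The shear \<open>x \<mapsto> x - r((x - a) \<bullet> v)\<close>, whose inverse is explicit because \<open>r\<close> is
  orthogonal to \<open>v\<close>, straightens that path and contradicts the diffeomorphism condition. Compactness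
  of the unit sphere of \<open>V\<close> gives the tangential derivative back from the directional limits.
\<close>

section \<open>C^1 curves through a prescribed sequence of points\<close>

text \<open>This is the profile of the bumps used below. At 0 the difference quotient is bounded by
  |h|, so the two smooth pieces fit together with derivative 0.\<close>

lemma has_field_derivative_max_0_power2:
  fixes u :: real
  shows "((\<lambda>u. (max 0 u)\<^sup>2) has_field_derivative 2 * max 0 u) (at u)"
proof (cases u "0::real" rule: linorder_cases)
  case less
  have "((\<lambda>u. 0) has_field_derivative 2 * max 0 u) (at u)"
    using less by (auto intro!: derivative_eq_intros)
  then show ?thesis
    by (rule has_field_derivative_transform_within_open[of _ _ _ "{..<0}"]) (use less in auto)
next
  case equal
  have "((\<lambda>h. (max 0 h)\<^sup>2 / h) \<longlongrightarrow> 0) (at (0::real))"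
    by (rule Lim_null_comparison[where g = "\<lambda>h. \<bar>h\<bar>"])
      (auto intro!: always_eventually tendsto_eq_intros simp: max_def power2_eq_square)
  then show ?thesis
    using equal by (simp add: has_field_derivative_iff)
next
  case greater
  have "((\<lambda>u. u\<^sup>2) has_field_derivative 2 * max 0 u) (at u)"
    using greater by (auto intro!: derivative_eq_intros)
  then show ?thesis
    by (rule has_field_derivative_transform_within_open[of _ _ _ "{0<..}"]) (use greater in auto)
qed

text \<open>By the Weierstrass M-test the derivatives converge uniformly. This permits termwise
  differentiation once the series converges at a single point, and it makes the derivative of the
  sum continuous.\<close>

lemma has_vector_derivative_series:
  fixes f :: "nat \<Rightarrow> real \<Rightarrow> 'a::banach"
  assumes d: "\<And>n x. (f n has_vector_derivative f' n x) (at x)"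
    and cont: "\<And>n. continuous_on UNIV (f' n)"
    and bound: "\<And>n x. norm (f' n x) \<le> M n" "summable M"
    and s: "summable (\<lambda>n. f n x0)"
  obtains F F' where "\<And>x. (\<lambda>n. f n x) sums F x" "\<And>x. (\<lambda>n. f' n x) sums F' x"
    "\<And>x. (F has_vector_derivative F' x) (at x)" "continuous_on UNIV F'"
proof -
  define F' where "F' = (\<lambda>x. \<Sum>n. f' n x)"
  have lim: "uniform_limit UNIV (\<lambda>n x. \<Sum>i<n. f' i x) F' sequentially"
    unfolding F'_def by (rule Weierstrass_m_test) (use bound in auto)
  have "\<exists>F. \<forall>x\<in>UNIV. (\<lambda>n. f n x) sums F x \<and> (F has_derivative (\<lambda>h. h *\<^sub>R F' x)) (at x within UNIV)"
  proof (rule has_derivative_series[where f' = "\<lambda>n x h. h *\<^sub>R f' n x"])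
    show "(\<lambda>n. f n x0) sums (\<Sum>n. f n x0)" using s by (rule summable_sums)
    show "\<forall>\<^sub>F n in sequentially. \<forall>x\<in>UNIV. \<forall>h. norm ((\<Sum>i<n. h *\<^sub>R f' i x) - h *\<^sub>R F' x) \<le> e * norm h"
      if "e > 0" for e
      using uniform_limitD[OF lim that]
    proof eventually_elim
      case (elim n)
      show ?case
      proof (intro ballI allI)
        fix x h
        have "(\<Sum>i<n. h *\<^sub>R f' i x) - h *\<^sub>R F' x = h *\<^sub>R ((\<Sum>i<n. f' i x) - F' x)"
          by (simp add: scaleR_right_diff_distrib scaleR_sum_right)
        moreover have "norm ((\<Sum>i<n. f' i x) - F' x) \<le> e"
          using elim by (auto simp: dist_norm intro: less_imp_le)
        ultimately show "norm ((\<Sum>i<n. h *\<^sub>R f' i x) - h *\<^sub>R F' x) \<le> e * norm h"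
          by (simp add: mult.commute[of e] mult_left_mono)
      qed
    qed
  qed (use d in \<open>auto simp: has_vector_derivative_def\<close>)
  moreover have "continuous_on UNIV F'"
    by (rule uniform_limit_theorem[OF _ lim])
      (auto intro!: always_eventually continuous_on_sum cont)
  moreover have "(\<lambda>n. f' n x) sums F' x" for x
    unfolding F'_def by (rule summable_sums, rule summable_comparison_test'[OF bound(2)])
      (use bound(1) in auto)
  ultimately show thesis
    using that unfolding has_vector_derivative_def by blast
qed

text \<open>A bump of height 1 around \<open>t k\<close>, of width proportional to
  \<open>t k\<close>, has slope at most \<open>16 / t k\<close>. The bound on \<open>s k\<close>
  cancels this factor, so the derivatives are dominated by a geometric series. All bumps vanish near
  0, each vanishes at the other nodes, and every relation \<open>s k \<bullet> v = 0\<close> passes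
  to the sum.\<close>

lemma C1_interpolation:
  fixes t :: "nat \<Rightarrow> real" and s :: "nat \<Rightarrow> 'a::euclidean_space"
  assumes pos: "\<And>k. 0 < t k" and halve: "\<And>k. t (Suc k) \<le> t k / 2"
    and small: "\<And>k. norm (s k) \<le> t k / 2 ^ k"
  obtains r r' where "\<And>x. (r has_vector_derivative r' x) (at x)" "continuous_on UNIV r'"
    "r 0 = 0" "r' 0 = 0" "\<And>k. r (t k) = s k"
    "\<And>v x. \<forall>k. s k \<bullet> v = 0 \<Longrightarrow> r x \<bullet> v = 0"
proof -
  \<comment> \<open>The rescaling places the support of the bump \<open>b k\<close> in the interval
    of radius \<open>t k / 4\<close> around \<open>t k\<close>; \<open>b' k\<close> is its
    derivative by the chain rule.\<close>
  define \<sigma> where "\<sigma> k x = 4 * (x - t k) / t k" for k x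
  define b where "b k x = (max 0 (1 - (\<sigma> k x)\<^sup>2))\<^sup>2" for k x
  define b' where "b' k x = - 16 / t k * (\<sigma> k x * max 0 (1 - (\<sigma> k x)\<^sup>2))" for k x
  have \<sigma>': "(\<sigma> k has_field_derivative 4 / t k) (at x)" for k x
    unfolding \<sigma>_def by (rule derivative_eq_intros refl)+ (use pos[of k] in \<open>auto simp: field_simps\<close>)
  have b'_deriv: "(b k has_field_derivative b' k x) (at x)" for k x
  proof -
    have "((\<lambda>x. 1 - (\<sigma> k x)\<^sup>2) has_field_derivative - 2 * \<sigma> k x * (4 / t k)) (at x)"
      by (rule derivative_eq_intros \<sigma>' refl)+ simp
    from DERIV_chain2[OF has_field_derivative_max_0_power2 this] show ?thesis
      by (simp add: b_def[abs_def] b'_def mult_ac)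
  qed
  have b'_cont: "continuous_on UNIV (b' k)" for k
    unfolding b'_def \<sigma>_def using pos[of k] by (auto intro!: continuous_intros)
  have b'_bound: "\<bar>b' k x\<bar> \<le> 16 / t k" for k x
  proof -
    have "\<bar>y * max 0 (1 - y\<^sup>2)\<bar> \<le> 1" for y :: real
    proof (cases "\<bar>y\<bar> \<le> 1")
      case True
      then have "y\<^sup>2 \<le> 1" by (simp add: abs_square_le_1)
      then have "\<bar>y\<bar> * \<bar>max 0 (1 - y\<^sup>2)\<bar> \<le> 1 * 1"
        using True by (intro mult_mono) auto
      then show ?thesis by (simp only: abs_mult mult_1)
    next
      case False
      then have "1 \<le> y\<^sup>2" using abs_square_less_1[of y] by linarith
      then show ?thesis by (simp add: max_def)
    qed
    then have "16 / t k * \<bar>\<sigma> k x * max 0 (1 - (\<sigma> k x)\<^sup>2)\<bar> \<le> 16 / t k * 1"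
      using pos[of k] by (intro mult_left_mono) auto
    moreover have "\<bar>b' k x\<bar> = 16 / t k * \<bar>\<sigma> k x * max 0 (1 - (\<sigma> k x)\<^sup>2)\<bar>"
      unfolding b'_def abs_mult[of "- 16 / t k"] using pos[of k] by simp
    ultimately show ?thesis by simp
  qed
  have b_zero: "b k x = 0" "b' k x = 0" if "\<bar>x - t k\<bar> \<ge> t k / 4" for k x
  proof -
    have "\<bar>\<sigma> k x\<bar> = 4 * \<bar>x - t k\<bar> / t k"
      unfolding \<sigma>_def abs_divide abs_mult using pos[of k] by simp
    then have "1 \<le> \<bar>\<sigma> k x\<bar>" using that pos[of k] by simp
    then have "1 \<le> (\<sigma> k x)\<^sup>2" using abs_square_less_1[of "\<sigma> k x"] by linarith
    then show "b k x = 0" "b' k x = 0" by (auto simp: b_def b'_def max_def)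
  qed
  have "t (Suc k) \<le> t k" for k
    using halve[of k] pos[of k] by simp
  then have "decseq t" by (rule decseq_SucI)
  then have sep: "t j \<le> t k / 2" if "k < j" for k j
    using decseqD[of t "Suc k" j] that halve[of k] by simp
  \<comment> \<open>Later nodes are at distance at least \<open>t k / 2\<close> from
    \<open>t k\<close> and earlier ones at distance at least \<open>t k\<close>, hence all lie
    outside the support of \<open>b k\<close>.\<close>
  have b_other: "b k (t j) = 0" if "j \<noteq> k" for j k
  proof (rule b_zero(1))
    show "\<bar>t j - t k\<bar> \<ge> t k / 4"
      using that sep[of j k] sep[of k j] pos[of k] pos[of j] by (cases "j < k") auto
  qed
  have zero: "b k 0 = 0" "b' k 0 = 0" for k
    using b_zero[where k = k and x = 0] pos[of k] by auto
  obtain r r' where r: "\<And>x. (\<lambda>n. b n x *\<^sub>R s n) sums r x" "\<And>x. (\<lambda>n. b' n x *\<^sub>R s n) sums r' x"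
    "\<And>x. (r has_vector_derivative r' x) (at x)" "continuous_on UNIV r'"
  proof (rule has_vector_derivative_series)
    show "((\<lambda>x. b n x *\<^sub>R s n) has_vector_derivative b' n x *\<^sub>R s n) (at x)" for n x
      by (rule derivative_eq_intros b'_deriv refl)+ simp
    show "continuous_on UNIV (\<lambda>x. b' n x *\<^sub>R s n)" for n
      by (intro continuous_intros b'_cont)
    show "norm (b' n x *\<^sub>R s n) \<le> 16 * (1 / 2) ^ n" for n x
    proof -
      have "norm (b' n x *\<^sub>R s n) \<le> 16 / t n * (t n / 2 ^ n)"
        unfolding norm_scaleR using b'_bound[of n x] small[of n] pos[of n] by (intro mult_mono) auto
      also have "\<dots> = 16 * (1 / 2) ^ n" using pos[of n] by (simp add: power_divide)
      finally show ?thesis .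
    qed
    show "summable (\<lambda>n. 16 * (1 / 2 :: real) ^ n)"
      by (intro summable_mult summable_geometric) simp
    show "summable (\<lambda>n. b n 0 *\<^sub>R s n)" by (simp add: zero)
  qed blast
  show thesis
  proof (rule that[OF r(3,4)])
    show "r 0 = 0" using r(1)[of 0] by (simp add: zero sums_unique2[OF _ sums_zero])
    show "r' 0 = 0" using r(2)[of 0] by (simp add: zero sums_unique2[OF _ sums_zero])
    show "r (t k) = s k" for k
    proof -
      have "b k (t k) = 1" by (simp add: b_def \<sigma>_def)
      then have "(\<lambda>n. b n (t k) *\<^sub>R s n) = (\<lambda>n. if n = k then s n else 0)"
        using b_other by fastforce
      then show ?thesis
        using r(1)[of "t k"] sums_single[of k s] sums_unique2 by metis
    qed
    show "r x \<bullet> v = 0" if "\<forall>k. s k \<bullet> v = 0" for v x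
      using bounded_linear.sums[OF bounded_linear_inner_left r(1)[of x], of v]
      by (simp add: that sums_unique2[OF _ sums_zero])
  qed
qed

section \<open>Reduction of the cone estimate to estimates along curves\<close>

text \<open>
  The cone around \<open>v\<close> is parametrised by its axis and an orthogonal displacement, and the error is
  measured by the axial coordinate \<open>t\<close> instead of \<open>\<parallel>x - a\<parallel>\<close>, so that \<open>t\<close> can serve as the parameter
  of a curve through prescribed points.
\<close>

definition approximable_in_cones ::
  "('a::euclidean_space \<Rightarrow> 'b::euclidean_space) \<Rightarrow> 'a set \<Rightarrow> 'a \<Rightarrow> 'a \<Rightarrow> 'b \<Rightarrow> bool" where
  "approximable_in_cones f A a v l \<longleftrightarrow>
     (\<forall>\<epsilon>>0. \<exists>\<theta>>0. \<forall>t s. 0 < t \<and> t \<le> \<theta> \<and> s \<bullet> v = 0 \<and> norm s \<le> \<theta> * t \<and> a + t *\<^sub>R v + s \<in> A \<longrightarrow>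
        norm (f (a + t *\<^sub>R v + s) - f a - t *\<^sub>R l) \<le> \<epsilon> * t)"

text \<open>Isolates what the path and the diffeomorphism conditions both have to supply: an
  estimate along each C^1 curve leaving \<open>a\<close> with velocity \<open>v\<close>. If the cone
  estimate fails, one such curve runs through infinitely many bad points converging to
  \<open>a\<close>.\<close>

lemma approximable_in_conesI_curve:
  fixes f :: "'a::euclidean_space \<Rightarrow> 'b::euclidean_space"
  assumes curve: "\<And>r r' \<epsilon>. \<lbrakk>\<And>x. (r has_vector_derivative r' x) (at x); continuous_on UNIV r'; r 0 = 0;
      r' 0 = 0; \<And>x. r x \<bullet> v = 0; (\<epsilon>::real) > 0\<rbrakk> \<Longrightarrow>
      \<exists>\<delta>>0. \<forall>t. \<bar>t\<bar> < \<delta> \<and> a + t *\<^sub>R v + r t \<in> A \<longrightarrow>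
        norm (f (a + t *\<^sub>R v + r t) - f a - t *\<^sub>R l) \<le> \<epsilon> * \<bar>t\<bar>"
  shows "approximable_in_cones f A a v l"
proof (rule ccontr)
  assume "\<not> ?thesis"
  then obtain \<epsilon> where "\<epsilon> > 0" and bad: "\<And>\<theta>. \<theta> > 0 \<Longrightarrow> \<exists>t s. 0 < t \<and> t \<le> \<theta> \<and> s \<bullet> v = 0 \<and>
      norm s \<le> \<theta> * t \<and> a + t *\<^sub>R v + s \<in> A \<and>
      norm (f (a + t *\<^sub>R v + s) - f a - t *\<^sub>R l) > \<epsilon> * t"
    unfolding approximable_in_cones_def by (auto simp: not_le)
  \<comment> \<open>A pair \<open>p\<close> holds the axial coordinate and the orthogonal
    displacement of a bad point in the cone of aperture \<open>1 / 2 ^ k\<close>.\<close>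
  define P where "P k p \<longleftrightarrow> 0 < fst p \<and> snd p \<bullet> v = 0 \<and> norm (snd p) \<le> fst p / 2 ^ k \<and>
      a + fst p *\<^sub>R v + snd p \<in> A \<and>
      norm (f (a + fst p *\<^sub>R v + snd p) - f a - fst p *\<^sub>R l) > \<epsilon> * fst p"
    for k :: nat and p :: "real \<times> 'a"
  have ex: "\<exists>p. P k p \<and> fst p \<le> c" if "c > 0" for k c
  proof -
    have "0 < min c (1 / 2 ^ k)" using that by simp
    \<comment> \<open>The minimum bounds the axial coordinate by \<open>c\<close> and the aperture
      by \<open>1 / 2 ^ k\<close> at once.\<close>
    then obtain t s where ts: "0 < t" "t \<le> min c (1 / 2 ^ k)" "s \<bullet> v = 0"
      "norm s \<le> min c (1 / 2 ^ k) * t" "a + t *\<^sub>R v + s \<in> A"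
      "norm (f (a + t *\<^sub>R v + s) - f a - t *\<^sub>R l) > \<epsilon> * t"
      using bad[of "min c (1 / 2 ^ k)"] by blast
    have "norm s \<le> 1 / 2 ^ k * t"
      using ts(1,4) by (meson min.cobounded2 mult_right_mono less_imp_le order_trans)
    then show ?thesis
      using ts by (intro exI[of _ "(t, s)"]) (auto simp: P_def)
  qed
  have "\<exists>p. \<forall>n. P n (p n) \<and> fst (p (Suc n)) \<le> fst (p n) / 2"
  \<comment> \<open>Each choice depends on the previous one, since the interpolation needs axial
    coordinates that at least halve.\<close>
  proof (rule dependent_nat_choice)
    show "\<exists>p. P 0 p" using ex[of 1 0] by auto
    show "\<exists>q. P (Suc n) q \<and> fst q \<le> fst p / 2" if "P n p" for p n
      using ex[of "fst p / 2" "Suc n"] that by (auto simp: P_def)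
  qed
  then obtain p where p: "\<And>n. P n (p n)" "\<And>n. fst (p (Suc n)) \<le> fst (p n) / 2" by blast
  obtain r r' where r: "\<And>x. (r has_vector_derivative r' x) (at x)" "continuous_on UNIV r'"
    "r 0 = 0" "r' 0 = 0" "\<And>k. r (fst (p k)) = snd (p k)"
    "\<And>u x. \<forall>k. snd (p k) \<bullet> u = 0 \<Longrightarrow> r x \<bullet> u = 0"
  proof (rule C1_interpolation)
    show "0 < fst (p k)" "fst (p (Suc k)) \<le> fst (p k) / 2" "norm (snd (p k)) \<le> fst (p k) / 2 ^ k" for k
      using p[of k] by (auto simp: P_def)
  qed blast
  obtain \<delta> where "\<delta> > 0" and \<delta>: "\<And>t. \<bar>t\<bar> < \<delta> \<Longrightarrow> a + t *\<^sub>R v + r t \<in> A \<Longrightarrow>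
        norm (f (a + t *\<^sub>R v + r t) - f a - t *\<^sub>R l) \<le> \<epsilon> * \<bar>t\<bar>"
    using curve[OF r(1-4) r(6) \<open>\<epsilon> > 0\<close>] p(1) unfolding P_def by blast
  have "fst (p n) \<le> fst (p 0) * (1 / 2) ^ n" for n
  proof (induction n)
    case (Suc n)
    then show ?case using p(2)[of n] by simp
  qed simp
  moreover have "(\<lambda>n. fst (p 0) * (1 / 2) ^ n) \<longlonglongrightarrow> 0"
    by (intro tendsto_mult_right_zero LIMSEQ_realpow_zero) auto
  then have "\<forall>\<^sub>F n in sequentially. fst (p 0) * (1 / 2) ^ n < \<delta>"
    using \<open>\<delta> > 0\<close> by (rule order_tendstoD)
  then obtain n where "fst (p 0) * (1 / 2) ^ n < \<delta>"
    by (auto simp: eventually_sequentially)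
  ultimately have "fst (p n) < \<delta>" by (meson le_less_trans)
  then show False
    using \<delta>[of "fst (p n)"] p(1)[of n] r(5)[of n] by (auto simp: P_def)
qed

text \<open>As \<open>r\<close> is orthogonal to \<open>v\<close>, the shear preserves the
  coordinate \<open>(x - a) \<bullet> v\<close>, so adding the same displacement back inverts it.
  Since \<open>r' 0 = 0\<close>, both derivatives at \<open>a\<close> are the identity, and neither
  \<open>V\<close> nor \<open>L\<close> changes under transport.\<close>

lemma shear:
  fixes r r' :: "real \<Rightarrow> 'a::euclidean_space" and a v :: 'a
  assumes r: "\<And>x. (r has_vector_derivative r' x) (at x)" "continuous_on UNIV r'" "r 0 = 0" "r' 0 = 0"
    and orth: "\<And>x. r x \<bullet> v = 0"
  defines "\<psi> \<equiv> \<lambda>x. x - r ((x - a) \<bullet> v)"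
  shows "diffeomorphism_on UNIV \<psi>"
    and "inv_into UNIV \<psi> = (\<lambda>y. y + r ((y - a) \<bullet> v))"
    and "frechet_derivative \<psi> (at a) = id"
    and "frechet_derivative (inv_into UNIV \<psi>) (at a) = id"
proof -
  \<comment> \<open>The factor \<open>c\<close> treats the shear (\<open>c = -1\<close>) and its
    inverse (\<open>c = 1\<close>) together.\<close>
  have deriv: "((\<lambda>x. x + c *\<^sub>R r ((x - a) \<bullet> v)) has_derivative
      blinfun_apply (id_blinfun + c *\<^sub>R (blinfun_scaleR_left (r' ((x - a) \<bullet> v)) o\<^sub>L blinfun_inner_left v))) (at x)"
    for c x
  proof -
    have "((\<lambda>x. r ((x - a) \<bullet> v)) has_derivative (\<lambda>h. (h \<bullet> v) *\<^sub>R r' ((x - a) \<bullet> v))) (at x)"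
      by (rule has_derivative_compose[where g = r and g' = "\<lambda>h. h *\<^sub>R r' ((x - a) \<bullet> v)"])
        (use r(1) in \<open>auto intro!: derivative_eq_intros simp: has_vector_derivative_def\<close>)
    then show ?thesis
      by (auto intro!: derivative_eq_intros simp: blinfun.bilinear_simps)
  qed
  have C1: "continuously_differentiable_on (\<lambda>x. x + c *\<^sub>R r ((x - a) \<bullet> v)) UNIV" for c
  proof -
    have "continuous_on UNIV (\<lambda>x. r' ((x - a) \<bullet> v))"
      by (rule continuous_on_compose2[OF r(2)]) (auto intro!: continuous_intros)
    then have "continuous_on UNIV
        (\<lambda>x. id_blinfun + c *\<^sub>R (blinfun_scaleR_left (r' ((x - a) \<bullet> v)) o\<^sub>L blinfun_inner_left v))"
      by (intro continuous_intros)
    then show ?thesis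
      unfolding continuously_differentiable_on_def by (intro exI conjI ballI) (rule deriv)
  qed
  have frechet: "frechet_derivative (\<lambda>x. x + c *\<^sub>R r ((x - a) \<bullet> v)) (at a) = id" for c
    using frechet_derivative_at[OF deriv[of c a]]
    by (auto simp: r blinfun.bilinear_simps fun_eq_iff)
  let ?\<phi> = "\<lambda>y. y + r ((y - a) \<bullet> v)"
  have inv: "?\<phi> (\<psi> x) = x" "\<psi> (?\<phi> x) = x" for x
    by (auto simp: \<psi>_def inner_diff_left inner_add_left orth)
  have "inj \<psi>" by (rule inj_on_inverseI[where g = ?\<phi>]) (rule inv(1))
  have "surj \<psi>" by (rule surjI[where f = ?\<phi>]) (rule inv(2))
  show inv_eq: "inv_into UNIV \<psi> = ?\<phi>"
    using inv by (intro inv_equality) auto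
  have \<psi>: "\<psi> = (\<lambda>x. x + (-1) *\<^sub>R r ((x - a) \<bullet> v))" and \<phi>: "?\<phi> = (\<lambda>x. x + 1 *\<^sub>R r ((x - a) \<bullet> v))"
    by (auto simp: \<psi>_def)
  have "continuously_differentiable_on ?\<phi> UNIV" unfolding \<phi> by (rule C1)
  moreover have "continuously_differentiable_on \<psi> UNIV" unfolding \<psi> by (rule C1)
  ultimately show "diffeomorphism_on UNIV \<psi>"
    using \<open>inj \<psi>\<close> \<open>surj \<psi>\<close> by (simp add: diffeomorphism_on_def inv_eq)
  show "frechet_derivative \<psi> (at a) = id" unfolding \<psi> by (rule frechet)
  show "frechet_derivative (inv_into UNIV \<psi>) (at a) = id" unfolding inv_eq \<phi> by (rule frechet)
qed

section \<open>Linear maps on a subspace\<close>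

lemma linear_maps_zero: "L \<in> linear_maps V \<Longrightarrow> subspace V \<Longrightarrow> L 0 = 0"
  unfolding linear_maps_def by (metis (mono_tags, lifting) mem_Collect_eq scale_zero_left subspace_0)

lemma linear_maps_scaleR: "L \<in> linear_maps V \<Longrightarrow> x \<in> V \<Longrightarrow> L (c *\<^sub>R x) = c *\<^sub>R L x"
  unfolding linear_maps_def by blast

text \<open>Makes facts about linear maps on the whole space available for \<open>L\<close>, whose
  values off \<open>V\<close> are arbitrary.\<close>

lemma linear_maps_extend:
  fixes L :: "'a::real_vector \<Rightarrow> 'b::real_vector"
  assumes L: "L \<in> linear_maps V" and V: "subspace V"
  obtains M where "linear M" "\<And>x. x \<in> V \<Longrightarrow> M x = L x"
proof -
  obtain B where B: "B \<subseteq> V" "independent B" "V \<subseteq> span B"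
    using maximal_independent_subset by blast
  then obtain M where M: "linear M" "\<forall>x\<in>B. M x = L x"
    using linear_independent_extend by blast
  have "x \<in> V \<and> M x = L x" if "x \<in> span B" for x
    using that
  proof (induction rule: span_induct_alt)
    case base
    then show ?case using linear_maps_zero[OF L V] M V by (simp add: linear_0 subspace_0)
  next
    case (step c x y)
    then have "x \<in> V" "c *\<^sub>R x \<in> V" using B V by (auto intro: subspace_scale)
    then show ?case
      using step M V L unfolding linear_maps_def
      by (simp add: linear_add linear_scale subspace_add)
  qed
  then show thesis using that M B by blast
qed

text \<open>A linear extension is bounded because the dimension is finite; its bound serves for
  differences in \<open>V\<close>.\<close>

lemma linear_maps_Lipschitz:
  fixes L :: "'a::euclidean_space \<Rightarrow> 'b::euclidean_space"
  assumes L: "L \<in> linear_maps V" and V: "subspace V"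
  obtains K where "K > 0" "\<And>x y. x \<in> V \<Longrightarrow> y \<in> V \<Longrightarrow> norm (L x - L y) \<le> K * norm (x - y)"
proof -
  obtain M where M: "linear M" "\<And>x. x \<in> V \<Longrightarrow> M x = L x"
    using linear_maps_extend[OF L V] by blast
  obtain K where "K > 0" "\<And>x. norm (M x) \<le> K * norm x"
    using linear_bounded_pos[OF M(1)] by blast
  moreover have "norm (L x - L y) = norm (M (x - y))" if "x \<in> V" "y \<in> V" for x y
    using M that by (simp add: linear_diff)
  ultimately show thesis
    using that by presburger
qed

section \<open>From tangential derivatives to diffeomorphisms and paths\<close>

text \<open>The lower bound on \<open>G\<close> makes \<open>norm (y - b)\<close> comparable with
  \<open>norm (g y - a)\<close>. The linearisation error of \<open>g\<close> is therefore small
  relative to \<open>norm (g y - a)\<close>, which puts \<open>G (y - b)\<close> among the vectors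
  that the tangential derivative admits at \<open>g y\<close>. Inverse diffeomorphisms and paths are
  both instances of \<open>g\<close>.\<close>

lemma tangential_derivative_compose:
  fixes g :: "'c::real_normed_vector \<Rightarrow> 'a::euclidean_space"
  assumes tan: "tangential_derivative f A a V L"
    and g: "(g has_derivative G) (at b within T)" "g b = a" "g ` T \<subseteq> A"
    and G: "\<And>y. y \<in> T \<Longrightarrow> G (y - b) \<in> V" "\<And>y. y \<in> T \<Longrightarrow> norm (y - b) \<le> K * norm (G (y - b))"
    and "K > 0" "\<epsilon> > 0"
  shows "\<exists>\<delta>>0. \<forall>y\<in>T. norm (y - b) < \<delta> \<longrightarrow> norm (f (g y) - f a - L (G (y - b))) \<le> \<epsilon> * norm (y - b)"
proof -
  have "bounded_linear G" using g(1) by (rule has_derivative_bounded_linear)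
  then obtain M where "M > 0" and M: "\<And>h. norm (G h) \<le> norm h * M"
    using bounded_linear.pos_bounded by blast
  \<comment> \<open>Near \<open>b\<close> the map \<open>g\<close> stretches distances from
    \<open>b\<close> by at most \<open>C\<close>, so the tolerance \<open>\<epsilon> / C\<close>
    becomes \<open>\<epsilon>\<close>.\<close>
  define C where "C = M + 1"
  have "C > 0" using \<open>M > 0\<close> by (simp add: C_def)
  obtain \<delta> \<theta> where "\<delta> > 0" "\<theta> > 0" and tan': "\<And>x v. \<lbrakk>x \<in> A; v \<in> V; norm (x - a) \<le> \<delta>;
      norm (x - a - v) \<le> \<theta> * norm (x - a)\<rbrakk> \<Longrightarrow> norm (f x - f a - L v) \<le> \<epsilon> / C * norm (x - a)"
    using tan[unfolded tangential_derivative_def, THEN conjunct2, rule_format, of "\<epsilon> / C"]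
      \<open>\<epsilon> > 0\<close> \<open>C > 0\<close> by auto
  \<comment> \<open>The bound 1 gives the stretching factor \<open>C\<close>;
    \<open>1 / (2 * K)\<close> lets half of \<open>norm (y - b)\<close> absorb the error in the
    lower estimate; \<open>\<theta> / (2 * K)\<close> then meets the aperture
    \<open>\<theta>\<close>.\<close>
  define \<eta> where "\<eta> = Min {1, 1 / (2 * K), \<theta> / (2 * K)}"
  have \<eta>: "\<eta> > 0" "\<eta> \<le> 1" "\<eta> \<le> 1 / (2 * K)" "\<eta> \<le> \<theta> / (2 * K)"
    using \<open>K > 0\<close> \<open>\<theta> > 0\<close> by (auto simp: \<eta>_def)
  obtain d where "d > 0" and d: "\<And>y. y \<in> T \<Longrightarrow> norm (y - b) < d \<Longrightarrow>
      norm (g y - a - G (y - b)) \<le> \<eta> * norm (y - b)"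
    using g(1,2) \<eta>(1) unfolding has_derivative_within_alt by metis
  show ?thesis
  proof (intro exI conjI ballI impI)
    show "min d (\<delta> / C) > 0" using \<open>d > 0\<close> \<open>\<delta> > 0\<close> \<open>C > 0\<close> by simp
    fix y assume y: "y \<in> T" and ny: "norm (y - b) < min d (\<delta> / C)"
    let ?n = "norm (y - b)" and ?x = "norm (g y - a)" and ?w = "G (y - b)"
    have app: "norm (g y - a - ?w) \<le> \<eta> * ?n" using d y ny by simp
    have "norm ?w \<le> ?x + \<eta> * ?n"
      using app norm_triangle_ineq4[of "g y - a" "g y - a - ?w"] by simp
    then have "K * norm ?w \<le> K * (?x + \<eta> * ?n)"
      using \<open>K > 0\<close> by simp
    also have "\<dots> = K * ?x + (K * \<eta>) * ?n" by (simp add: algebra_simps)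
    also have "\<dots> \<le> K * ?x + 1 / 2 * ?n"
      using \<eta>(3) \<open>K > 0\<close> by (intro add_left_mono mult_right_mono) (auto simp: field_simps)
    finally have n_le: "?n \<le> 2 * K * ?x" using G(2)[OF y] by simp
    have "\<eta> * ?n \<le> \<theta> / (2 * K) * (2 * K * ?x)"
      using \<eta> n_le \<open>K > 0\<close> \<open>\<theta> > 0\<close> by (intro mult_mono) auto
    then have "norm (g y - a - ?w) \<le> \<theta> * ?x" using app \<open>K > 0\<close> by simp
    moreover have x_le: "?x \<le> C * ?n"
    proof -
      have "?x \<le> norm ?w + norm (g y - a - ?w)" by (metis norm_triangle_sub)
      also have "\<dots> \<le> ?n * M + 1 * ?n"
        using M[of "y - b"] app \<eta>(2) by (meson add_mono mult_right_mono norm_ge_zero order_trans)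
      finally show ?thesis by (simp add: C_def algebra_simps)
    qed
    moreover have "C * ?n \<le> \<delta>" using ny \<open>C > 0\<close> by (simp add: field_simps)
    ultimately have "norm (f (g y) - f a - L ?w) \<le> \<epsilon> / C * ?x"
      using tan' g(3) G(1) y by (meson image_subset_iff order_trans)
    also have "\<dots> \<le> \<epsilon> / C * (C * ?n)"
      using x_le \<open>\<epsilon> > 0\<close> \<open>C > 0\<close> by (intro mult_left_mono) auto
    finally show "norm (f (g y) - f a - L ?w) \<le> \<epsilon> * ?n" using \<open>C > 0\<close> by simp
  qed
qed

text \<open>Brings differentiability along a path into the form of the composition estimate.\<close>

lemma has_vector_derivative_at_0_within_iff:
  "(g has_vector_derivative l) (at 0 within T) \<longleftrightarrow>
     (\<forall>\<epsilon>>0. \<exists>\<delta>>0. \<forall>t\<in>T. \<bar>t\<bar> < \<delta> \<longrightarrow> norm (g t - g 0 - t *\<^sub>R l) \<le> \<epsilon> * \<bar>t\<bar>)"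
  by (simp add: has_vector_derivative_def has_derivative_within_alt bounded_linear_scaleR_left)

lemma continuously_differentiable_on_has_derivative:
  assumes "continuously_differentiable_on f S" "x \<in> S"
  shows "(f has_derivative frechet_derivative f (at x)) (at x)"
proof -
  have "f differentiable (at x)"
    using assms unfolding continuously_differentiable_on_def differentiable_def by blast
  then show ?thesis by (simp add: frechet_derivative_works)
qed

text \<open>The composition estimate is applied to the inverse of \<open>\<psi>\<close>, restricted
  to the part of \<open>\<psi>\<close> U\<open>in the affine subspace through\<close>\<psi>
  a\<open>with direction\<close>D \<open>V\<close>; there \<open>G\<close> takes values in
  \<open>V\<close>.\<close>

lemma tangential_imp_transported_directional_derivative:
  assumes tan: "tangential_derivative f A a V L" and V: "subspace V"
    and \<psi>: "diffeomorphism_on W \<psi>" and U: "U \<subseteq> W" "U \<subseteq> A" "a \<in> U"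
  shows "transported_directional_derivative f a V L W U \<psi>"
proof -
  define g D G where "g = inv_into W \<psi>" and "D = frechet_derivative \<psi> (at a)"
    and "G = frechet_derivative g (at (\<psi> a))"
  have inj: "inj_on \<psi> W" and "open W" using \<psi> by (auto simp: diffeomorphism_on_def)
  have "a \<in> W" using U by blast
  have D: "(\<psi> has_derivative D) (at a)"
    using \<psi> \<open>a \<in> W\<close> unfolding D_def diffeomorphism_on_def
    by (blast intro: continuously_differentiable_on_has_derivative)
  have G: "(g has_derivative G) (at (\<psi> a))"
    using \<psi> \<open>a \<in> W\<close> unfolding G_def g_def diffeomorphism_on_def
    by (blast intro: continuously_differentiable_on_has_derivative)
  have g\<psi>: "g (\<psi> x) = x" if "x \<in> W" for x
    using inj that by (simp add: g_def)
  have "((\<lambda>x. g (\<psi> x)) has_derivative (\<lambda>h. G (D h))) (at a)"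
    using D G by (rule has_derivative_compose)
  then have "((\<lambda>x. x) has_derivative (\<lambda>h. G (D h))) (at a)"
    by (rule has_derivative_transform_within_open[OF _ \<open>open W\<close> \<open>a \<in> W\<close>]) (rule g\<psi>)
  then have GD: "G (D h) = h" for h
    using has_derivative_unique[OF _ has_derivative_ident] by metis
  have "bounded_linear D" using D by (rule has_derivative_bounded_linear)
  then obtain K where K: "K > 0" "\<And>h. norm (D h) \<le> norm h * K"
    using bounded_linear.pos_bounded by blast
  have "linear D" using \<open>bounded_linear D\<close> by (rule bounded_linear.linear)
  have "L \<in> linear_maps V" using tan by (simp add: tangential_derivative_def)
  then have "L \<circ> G \<in> linear_maps (D ` V)"
    using V unfolding linear_maps_def
    by (auto simp: linear_add[OF \<open>linear D\<close>, symmetric] linear_scale[OF \<open>linear D\<close>, symmetric] GD)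
  moreover
  let ?T = "\<psi> ` U \<inter> (\<lambda>v. v + \<psi> a) ` D ` V"
  have "\<exists>\<delta>>0. \<forall>y\<in>?T. norm (y - \<psi> a) \<le> \<delta> \<longrightarrow>
      norm ((f \<circ> g) y - (f \<circ> g) (\<psi> a) - (L \<circ> G) (y - \<psi> a)) \<le> \<epsilon> * norm (y - \<psi> a)"
    if "\<epsilon> > 0" for \<epsilon>
  proof -
    have "\<exists>\<delta>>0. \<forall>y\<in>?T. norm (y - \<psi> a) < \<delta> \<longrightarrow>
      norm (f (g y) - f a - L (G (y - \<psi> a))) \<le> \<epsilon> * norm (y - \<psi> a)"
    proof (rule tangential_derivative_compose[OF tan])
      show "(g has_derivative G) (at (\<psi> a) within ?T)"
        using G by (rule has_derivative_at_withinI)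
      have "g (\<psi> x) \<in> A" if "x \<in> U" for x using that g\<psi>[of x] U by (simp add: subset_iff)
      then show "g ` ?T \<subseteq> A" by blast
      \<comment> \<open>With \<open>y - \<psi> a = D h\<close> and \<open>G (D h) = h\<close>, the
        lower bound for \<open>G\<close> is the boundedness of \<open>D\<close>.\<close>
      show "norm (y - \<psi> a) \<le> K * norm (G (y - \<psi> a))" if "y \<in> ?T" for y
        using that K(2) by (auto simp: GD mult.commute[of K])
    qed (use g\<psi> \<open>a \<in> W\<close> K(1) that in \<open>auto simp: GD\<close>)
    then obtain \<delta> where "\<delta> > 0" and \<delta>: "\<And>y. y \<in> ?T \<Longrightarrow> norm (y - \<psi> a) < \<delta> \<Longrightarrow>
      norm (f (g y) - f a - L (G (y - \<psi> a))) \<le> \<epsilon> * norm (y - \<psi> a)" by blast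
    \<comment> \<open>Halving \<open>\<delta>\<close> passes from the strict to the weak
      inequality.\<close>
    then show ?thesis
      using g\<psi>[OF \<open>a \<in> W\<close>] by (intro exI[of _ "\<delta> / 2"]) auto
  qed
  ultimately show ?thesis
    unfolding transported_directional_derivative_def directional_derivative_def
    by (simp only: g_def D_def G_def) blast
qed

text \<open>The linear part \<open>t *\<^sub>R w\<close> stays in \<open>V\<close>, and
  \<open>w \<noteq> 0\<close> provides the lower bound with constant
  \<open>1 / norm w\<close>.\<close>

lemma tangential_imp_path_derivative:
  assumes tan: "tangential_derivative f A a V L" and V: "subspace V"
    and \<gamma>: "(\<gamma> has_vector_derivative w) (at 0)" "\<gamma> 0 = a" "\<gamma> ` T \<subseteq> A" and w: "w \<in> V" "w \<noteq> 0"
  shows "((f \<circ> \<gamma>) has_vector_derivative L w) (at 0 within T)"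
  unfolding has_vector_derivative_at_0_within_iff
proof (intro allI impI)
  fix \<epsilon> :: real assume "\<epsilon> > 0"
  have L: "L \<in> linear_maps V" using tan by (simp add: tangential_derivative_def)
  have "\<exists>\<delta>>0. \<forall>t\<in>T. norm (t - 0) < \<delta> \<longrightarrow>
      norm (f (\<gamma> t) - f a - L ((t - 0) *\<^sub>R w)) \<le> \<epsilon> * norm (t - 0)"
  proof (rule tangential_derivative_compose[OF tan, where K = "1 / norm w"])
    show "(\<gamma> has_derivative (\<lambda>t. t *\<^sub>R w)) (at 0 within T)"
      using \<gamma>(1) unfolding has_vector_derivative_def by (rule has_derivative_at_withinI)
  qed (use \<gamma> w V \<open>\<epsilon> > 0\<close> in \<open>auto intro: subspace_scale\<close>)
  then show "\<exists>\<delta>>0. \<forall>t\<in>T. \<bar>t\<bar> < \<delta> \<longrightarrow>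
      norm ((f \<circ> \<gamma>) t - (f \<circ> \<gamma>) 0 - t *\<^sub>R L w) \<le> \<epsilon> * \<bar>t\<bar>"
    using \<gamma>(2) linear_maps_scaleR[OF L w(1)] by simp
qed

section \<open>From diffeomorphisms and paths to cones\<close>

lemma transported_imp_approximable_in_cones:
  fixes f :: "'a::euclidean_space \<Rightarrow> 'b::euclidean_space"
  assumes "a \<in> A" and L: "L \<in> linear_maps V" and V: "subspace V"
    and transported: "\<And>\<psi>. diffeomorphism_on UNIV \<psi> \<Longrightarrow> transported_directional_derivative f a V L UNIV A \<psi>"
    and v: "v \<in> V" "norm v = 1"
  shows "approximable_in_cones f A a v (L v)"
proof (rule approximable_in_conesI_curve)
  fix r r' :: "real \<Rightarrow> 'a" and \<epsilon> :: real
  assume r: "\<And>x. (r has_vector_derivative r' x) (at x)" "continuous_on UNIV r'" "r 0 = 0" "r' 0 = 0"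
    "\<And>x. r x \<bullet> v = 0" and "\<epsilon> > 0"
  define \<psi> where "\<psi> = (\<lambda>x. x - r ((x - a) \<bullet> v))"
  note shear = shear[OF r, where a = a, folded \<psi>_def]
  have \<psi>a: "\<psi> a = a" by (simp add: \<psi>_def r)
  have "directional_derivative (f \<circ> (\<lambda>y. y + r ((y - a) \<bullet> v))) (\<psi> ` A) a V L"
    using transported[OF shear(1)] unfolding transported_directional_derivative_def
    by (simp add: \<psi>a shear(3) shear(4)[unfolded shear(2)] shear(2))
  then obtain \<delta> where "\<delta> > 0" and \<delta>: "\<And>y. y \<in> \<psi> ` A \<Longrightarrow> y \<in> (\<lambda>v. v + a) ` V \<Longrightarrow> norm (y - a) \<le> \<delta> \<Longrightarrow>
      norm (f (y + r ((y - a) \<bullet> v)) - f a - L (y - a)) \<le> \<epsilon> * norm (y - a)"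
    using \<open>\<epsilon> > 0\<close> unfolding directional_derivative_def by (auto simp: r)
  have "norm (f (a + t *\<^sub>R v + r t) - f a - t *\<^sub>R L v) \<le> \<epsilon> * \<bar>t\<bar>"
    if "\<bar>t\<bar> < \<delta>" "a + t *\<^sub>R v + r t \<in> A" for t
  proof -
    have vv: "v \<bullet> v = 1" using v(2) by (simp add: norm_eq_1)
    \<comment> \<open>The shear carries the curve to a line in \<open>V + a\<close>, where the
      directional derivative applies.\<close>
    have "\<psi> (a + t *\<^sub>R v + r t) = a + t *\<^sub>R v"
      by (simp add: \<psi>_def inner_add_left r vv)
    then have "a + t *\<^sub>R v \<in> \<psi> ` A" using that(2) by (metis imageI)
    moreover have "a + t *\<^sub>R v \<in> (\<lambda>v. v + a) ` V"
      using V v by (auto simp: add.commute intro: subspace_scale)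
    ultimately show ?thesis
      using \<delta>[of "a + t *\<^sub>R v"] that(1) v linear_maps_scaleR[OF L v(1)] by (simp add: vv)
  qed
  then show "\<exists>\<delta>>0. \<forall>t. \<bar>t\<bar> < \<delta> \<and> a + t *\<^sub>R v + r t \<in> A \<longrightarrow>
      norm (f (a + t *\<^sub>R v + r t) - f a - t *\<^sub>R L v) \<le> \<epsilon> * \<bar>t\<bar>"
    using \<open>\<delta> > 0\<close> by blast
qed

text \<open>Since \<open>r' 0 = 0\<close>, the curve \<open>a + t *\<^sub>R v + r t\<close> is
  itself a path with velocity \<open>v\<close> at 0.\<close>

lemma path_derivative_imp_approximable_in_cones:
  fixes f :: "'a::euclidean_space \<Rightarrow> 'b::euclidean_space"
  assumes path: "\<And>\<gamma>. \<gamma> C1_differentiable_on {-1<..<1} \<Longrightarrow> \<gamma> 0 = a \<Longrightarrow> vector_derivative \<gamma> (at 0) = v \<Longrightarrow>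
      ((f \<circ> \<gamma>) has_vector_derivative l) (at 0 within {t \<in> {-1<..<1}. \<gamma> t \<in> A})"
  shows "approximable_in_cones f A a v l"
proof (rule approximable_in_conesI_curve)
  fix r r' :: "real \<Rightarrow> 'a" and \<epsilon> :: real
  assume r: "\<And>x. (r has_vector_derivative r' x) (at x)" "continuous_on UNIV r'" "r 0 = 0" "r' 0 = 0"
    "\<And>x. r x \<bullet> v = 0" and "\<epsilon> > 0"
  define \<gamma> where "\<gamma> = (\<lambda>t. a + t *\<^sub>R v + r t)"
  have d: "(\<gamma> has_vector_derivative v + r' t) (at t)" for t
    unfolding \<gamma>_def by (auto intro!: derivative_eq_intros r)
  have "((f \<circ> \<gamma>) has_vector_derivative l) (at 0 within {t \<in> {-1<..<1}. \<gamma> t \<in> A})"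
  proof (rule path)
    have "continuous_on {-1<..<1} (\<lambda>t. v + r' t)"
      by (intro continuous_intros continuous_on_subset[OF r(2)]) simp
    then show "\<gamma> C1_differentiable_on {-1<..<1}"
      unfolding C1_differentiable_on_def by (intro exI conjI ballI) (rule d)
    show "\<gamma> 0 = a" by (simp add: \<gamma>_def r)
    show "vector_derivative \<gamma> (at 0) = v"
      using vector_derivative_at[OF d[of 0]] by (simp add: r)
  qed
  then obtain \<delta> where "\<delta> > 0" and "\<And>t. \<bar>t\<bar> < 1 \<Longrightarrow> \<gamma> t \<in> A \<Longrightarrow> \<bar>t\<bar> < \<delta> \<Longrightarrow>
      norm ((f \<circ> \<gamma>) t - (f \<circ> \<gamma>) 0 - t *\<^sub>R l) \<le> \<epsilon> * \<bar>t\<bar>"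
    using \<open>\<epsilon> > 0\<close> unfolding has_vector_derivative_at_0_within_iff by (auto simp: abs_less_iff)
  then show "\<exists>\<delta>>0. \<forall>t. \<bar>t\<bar> < \<delta> \<and> a + t *\<^sub>R v + r t \<in> A \<longrightarrow>
      norm (f (a + t *\<^sub>R v + r t) - f a - t *\<^sub>R l) \<le> \<epsilon> * \<bar>t\<bar>"
    by (intro exI[of _ "min \<delta> 1"]) (auto simp: \<gamma>_def r)
qed

section \<open>Directional limits and compactness\<close>

text \<open>The limit in (iv) for a single \<open>v\<close>, with the value \<open>L v\<close>
  replaced by a free \<open>l\<close>. Its content lies on the unit sphere: for any other
  \<open>v\<close> a small \<open>\<theta>\<close> leaves no point \<open>x\<close>.\<close>

definition approximable_in_direction ::
  "('a::euclidean_space \<Rightarrow> 'b::euclidean_space) \<Rightarrow> 'a set \<Rightarrow> 'a \<Rightarrow> 'a \<Rightarrow> 'b \<Rightarrow> bool" where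
  "approximable_in_direction f A a v l \<longleftrightarrow>
     (\<forall>\<epsilon>>0. \<exists>\<delta>>0. \<exists>\<theta>>0. \<forall>x \<in> A - {a}.
        norm (x - a) \<le> \<delta> \<and> norm ((x - a) /\<^sub>R norm (x - a) - v) \<le> \<theta> \<longrightarrow>
        norm (f x - f a - norm (x - a) *\<^sub>R l) \<le> \<epsilon> * norm (x - a))"

text \<open>Multiplying the closeness of directions by \<open>norm (x - a)\<close> gives the
  tangential condition for the vector \<open>norm (x - a) *\<^sub>R v\<close> of
  \<open>V\<close>.\<close>

lemma tangential_imp_approximable_in_direction:
  assumes tan: "tangential_derivative f A a V L" and V: "subspace V" and v: "v \<in> V"
  shows "approximable_in_direction f A a v (L v)"
  unfolding approximable_in_direction_def
proof (intro allI impI)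
  fix \<epsilon> :: real assume "\<epsilon> > 0"
  have L: "L \<in> linear_maps V" using tan by (simp add: tangential_derivative_def)
  obtain \<delta> \<theta> where "\<delta> > 0" "\<theta> > 0" and tan': "\<And>x v. \<lbrakk>x \<in> A; v \<in> V; norm (x - a) \<le> \<delta>;
      norm (x - a - v) \<le> \<theta> * norm (x - a)\<rbrakk> \<Longrightarrow> norm (f x - f a - L v) \<le> \<epsilon> * norm (x - a)"
    using tan \<open>\<epsilon> > 0\<close> unfolding tangential_derivative_def by blast
  have "norm (f x - f a - norm (x - a) *\<^sub>R L v) \<le> \<epsilon> * norm (x - a)"
    if x: "x \<in> A - {a}" "norm (x - a) \<le> \<delta>" "norm ((x - a) /\<^sub>R norm (x - a) - v) \<le> \<theta>" for x
  proof -
    have n: "norm (x - a) > 0" using x by simp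
    have "x - a - norm (x - a) *\<^sub>R v = norm (x - a) *\<^sub>R ((x - a) /\<^sub>R norm (x - a) - v)"
      using n by (simp add: scaleR_right_diff_distrib)
    then have "norm (x - a - norm (x - a) *\<^sub>R v) \<le> \<theta> * norm (x - a)"
      using x(3) n by (simp add: mult.commute mult_right_mono)
    then show ?thesis
      using tan'[of x "norm (x - a) *\<^sub>R v"] x v V by (simp add: subspace_scale linear_maps_scaleR[OF L])
  qed
  then show "\<exists>\<delta>>0. \<exists>\<theta>>0. \<forall>x \<in> A - {a}.
        norm (x - a) \<le> \<delta> \<and> norm ((x - a) /\<^sub>R norm (x - a) - v) \<le> \<theta> \<longrightarrow>
        norm (f x - f a - norm (x - a) *\<^sub>R L v) \<le> \<epsilon> * norm (x - a)"
    using \<open>\<delta> > 0\<close> \<open>\<theta> > 0\<close> by blast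
qed

text \<open>A point whose direction is close to \<open>v\<close> lies in a thin cone. Its axial
  coordinate \<open>t\<close> differs from \<open>norm (x - a)\<close> by a small proportion, and
  replacing one by the other costs half of the tolerance.\<close>

lemma approximable_in_cones_imp_direction:
  fixes f :: "'a::euclidean_space \<Rightarrow> 'b::euclidean_space"
  assumes cones: "approximable_in_cones f A a v l" and v: "norm v = 1"
  shows "approximable_in_direction f A a v l"
  unfolding approximable_in_direction_def
proof (intro allI impI)
  fix \<epsilon> :: real assume "\<epsilon> > 0"
  obtain \<theta> where "\<theta> > 0" and \<theta>: "\<And>t s. \<lbrakk>0 < t; t \<le> \<theta>; s \<bullet> v = 0; norm s \<le> \<theta> * t;
      a + t *\<^sub>R v + s \<in> A\<rbrakk> \<Longrightarrow> norm (f (a + t *\<^sub>R v + s) - f a - t *\<^sub>R l) \<le> \<epsilon> / 2 * t"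
    using cones[unfolded approximable_in_cones_def, rule_format, of "\<epsilon> / 2"] \<open>\<epsilon> > 0\<close> by auto
  \<comment> \<open>The entry \<open>1 / 2\<close> keeps the axial part at least half of the length,
    \<open>\<theta> / 2\<close> then bounds the displacement by \<open>\<theta> * t\<close>, and the
    last entry bounds the cost of replacing \<open>t\<close> by the length; the \<open>+ 1\<close>
    covers \<open>l = 0\<close>.\<close>
  define \<eta> where "\<eta> = Min {1 / 2, \<theta> / 2, \<epsilon> / (2 * (norm l + 1))}"
  have "norm l + 1 > 0" by (simp add: add_nonneg_pos)
  then have \<eta>: "\<eta> > 0" "\<eta> \<le> 1 / 2" "\<eta> \<le> \<theta> / 2" "\<eta> \<le> \<epsilon> / (2 * (norm l + 1))"
    unfolding \<eta>_def using \<open>\<theta> > 0\<close> \<open>\<epsilon> > 0\<close> by simp (intro Min_le; simp)+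
  have \<eta>l: "\<eta> * norm l \<le> \<epsilon> / 2"
  proof -
    have "\<eta> * norm l \<le> \<eta> * (norm l + 1)" using \<eta>(1) by simp
    also have "\<dots> \<le> \<epsilon> / 2" using \<eta>(4) \<open>norm l + 1 > 0\<close> by (simp add: field_simps)
    finally show ?thesis .
  qed
  have "norm (f x - f a - norm (x - a) *\<^sub>R l) \<le> \<epsilon> * norm (x - a)"
    if x: "x \<in> A - {a}" "norm (x - a) \<le> \<theta>" "norm ((x - a) /\<^sub>R norm (x - a) - v) \<le> \<eta>" for x
  proof -
    \<comment> \<open>\<open>c\<close> is the cosine of the angle between \<open>x - a\<close> and
      \<open>v\<close>, so \<open>n * c\<close> is the axial coordinate.\<close>
    define n u c where "n = norm (x - a)" and "u = (x - a) /\<^sub>R norm (x - a)" and "c = u \<bullet> v"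
    have n: "n > 0" using x by (simp add: n_def)
    have xu: "x - a = n *\<^sub>R u" and nu: "norm u = 1" using n by (auto simp: n_def u_def)
    have vv: "v \<bullet> v = 1" and uu: "u \<bullet> u = 1" using v nu by (auto simp: norm_eq_1)
    have uv: "norm (u - v) \<le> \<eta>" using x(3) by (simp add: u_def)
    have "\<bar>(u - v) \<bullet> v\<bar> \<le> norm (u - v) * norm v" by (rule Cauchy_Schwarz_ineq2)
    then have c1: "\<bar>c - 1\<bar> \<le> \<eta>" using uv v by (simp add: c_def inner_diff_left vv)
    have "c \<le> 1" using Cauchy_Schwarz_ineq2[of u v] nu v by (simp add: c_def)
    have c: "1 / 2 \<le> c" using c1 \<eta>(2) by linarith
    define t s where "t = n * c" and "s = n *\<^sub>R (u - c *\<^sub>R v)"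
    have x_eq: "x = a + t *\<^sub>R v + s"
      using xu by (simp add: t_def s_def algebra_simps)
    have t: "t > 0" "t \<le> n" using n c \<open>c \<le> 1\<close> by (auto simp: t_def mult_left_le)
    have "s \<bullet> v = 0" by (simp add: s_def inner_diff_left vv c_def)
    have "norm (u - c *\<^sub>R v) \<le> norm (u - v)"
    proof (rule norm_le_square[THEN iffD2, OF conjI])
      \<comment> \<open>Pythagoras: \<open>u - v\<close> is the orthogonal sum of
        \<open>u - c *\<^sub>R v\<close> and \<open>(c - 1) *\<^sub>R v\<close>.\<close>
      have "(u - c *\<^sub>R v) \<bullet> (u - c *\<^sub>R v) = (u - v) \<bullet> (u - v) - (c - 1)\<^sup>2"
        by (simp add: inner_diff_left inner_diff_right vv uu c_def inner_commute[of v u]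
            power2_eq_square algebra_simps)
      then show "(u - c *\<^sub>R v) \<bullet> (u - c *\<^sub>R v) \<le> (norm (u - v))\<^sup>2"
        by (simp add: power2_norm_eq_inner)
    qed simp
    then have "norm s \<le> n * \<eta>" using n uv by (simp add: s_def)
    also have "\<dots> \<le> n * (\<theta> * c)"
    proof -
      have "\<theta> / 2 \<le> \<theta> * c" using c \<open>\<theta> > 0\<close> by (simp add: field_simps)
      then show ?thesis using \<eta>(3) n by simp
    qed
    finally have s: "norm s \<le> \<theta> * t" by (simp add: t_def mult_ac)
    have "norm (f x - f a - t *\<^sub>R l) \<le> \<epsilon> / 2 * t"
      unfolding x_eq using \<theta>[OF t(1) _ \<open>s \<bullet> v = 0\<close> s] t(2) x(1,2) x_eq n_def by simp
    also have "\<dots> \<le> \<epsilon> / 2 * n" using t \<open>\<epsilon> > 0\<close> by simp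
    finally have 1: "norm (f x - f a - t *\<^sub>R l) \<le> \<epsilon> / 2 * n" .
    have "norm ((n - t) *\<^sub>R l) = n * (\<bar>c - 1\<bar> * norm l)"
    proof -
      have "n - t = n * (1 - c)" by (simp add: t_def algebra_simps)
      then show ?thesis using n by (simp add: abs_mult abs_minus_commute)
    qed
    also have "\<dots> \<le> n * (\<eta> * norm l)"
      using c1 n by (intro mult_left_mono mult_right_mono) auto
    also have "\<dots> \<le> n * (\<epsilon> / 2)" using \<eta>l n by simp
    finally have "norm ((n - t) *\<^sub>R l) \<le> \<epsilon> / 2 * n" by (simp add: mult.commute)
    with 1 have "norm ((f x - f a - t *\<^sub>R l) - (n - t) *\<^sub>R l) \<le> \<epsilon> / 2 * n + \<epsilon> / 2 * n"
      by (intro order_trans[OF norm_triangle_ineq4 add_mono])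
    moreover have "(f x - f a - t *\<^sub>R l) - (n - t) *\<^sub>R l = f x - f a - n *\<^sub>R l"
      by (simp add: algebra_simps)
    ultimately have "norm (f x - f a - n *\<^sub>R l) \<le> \<epsilon> / 2 * n + \<epsilon> / 2 * n"
      by (simp only:)
    then show ?thesis by (simp add: n_def)
  qed
  then show "\<exists>\<delta>>0. \<exists>\<theta>>0. \<forall>x \<in> A - {a}.
        norm (x - a) \<le> \<delta> \<and> norm ((x - a) /\<^sub>R norm (x - a) - v) \<le> \<theta> \<longrightarrow>
        norm (f x - f a - norm (x - a) *\<^sub>R l) \<le> \<epsilon> * norm (x - a)"
    using \<open>\<theta> > 0\<close> \<eta>(1) by blast
qed

text \<open>The radii in the directional limits depend on the direction. A sequence of
  counterexamples has directions that accumulate at a unit vector \<open>z\<close> of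
  \<open>V\<close>, and the limit at \<open>z\<close> alone contradicts it.\<close>

lemma approximable_in_direction_imp_tangential:
  fixes f :: "'a::euclidean_space \<Rightarrow> 'b::euclidean_space"
  assumes L: "L \<in> linear_maps V" and V: "subspace V"
    and dir: "\<And>v. v \<in> V \<Longrightarrow> norm v = 1 \<Longrightarrow> approximable_in_direction f A a v (L v)"
  shows "tangential_derivative f A a V L"
proof (rule ccontr)
  assume "\<not> ?thesis"
  then obtain \<epsilon> where "\<epsilon> > 0" and bad: "\<And>\<delta> \<theta>. \<delta> > 0 \<Longrightarrow> \<theta> > 0 \<Longrightarrow> \<exists>x\<in>A. \<exists>v\<in>V.
      norm (x - a) \<le> \<delta> \<and> norm (x - a - v) \<le> \<theta> * norm (x - a) \<and>
      norm (f x - f a - L v) > \<epsilon> * norm (x - a)"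
    using L unfolding tangential_derivative_def by (auto simp: not_le)
  have "\<exists>x v. x \<in> A \<and> v \<in> V \<and> norm (x - a) \<le> inverse (real (Suc k)) \<and>
      norm (x - a - v) \<le> inverse (real (Suc k)) * norm (x - a) \<and>
      norm (f x - f a - L v) > \<epsilon> * norm (x - a)" for k
    using bad[of "inverse (real (Suc k))" "inverse (real (Suc k))"] by force
  then obtain x v where xv: "\<And>k. x k \<in> A" "\<And>k. v k \<in> V" "\<And>k. norm (x k - a) \<le> inverse (real (Suc k))"
      "\<And>k. norm (x k - a - v k) \<le> inverse (real (Suc k)) * norm (x k - a)"
      "\<And>k. norm (f (x k) - f a - L (v k)) > \<epsilon> * norm (x k - a)"
    by metis
  define n u w where "n k = norm (x k - a)" and "u k = (x k - a) /\<^sub>R norm (x k - a)"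
    and "w k = v k /\<^sub>R norm (x k - a)" for k
  \<comment> \<open>Equality would force \<open>v k = 0\<close>, and then the strict inequality
    would read \<open>0 > 0\<close>.\<close>
  have "x k \<noteq> a" for k
    using xv(4,5)[of k] linear_maps_zero[OF L V] by auto
  then have n: "n k > 0" for k by (simp add: n_def)
  have u: "u k \<in> sphere 0 1" for k using n[of k] by (simp add: n_def u_def)
  have w: "w k \<in> V" for k using xv(2) V by (simp add: w_def subspace_scale)
  have v_eq: "v k = n k *\<^sub>R w k" for k using n[of k] by (simp add: n_def w_def)
  have uw: "norm (u k - w k) \<le> inverse (real (Suc k))" for k
  proof -
    have "norm (u k - w k) = norm (x k - a - v k) / n k"
      using n[of k] by (simp add: u_def w_def n_def scaleR_right_diff_distrib[symmetric] divide_inverse mult.commute)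
    then show ?thesis using xv(4)[of k] n[of k] by (simp add: n_def pos_divide_le_eq)
  qed
  obtain z \<rho> where z: "z \<in> sphere 0 1" and \<rho>: "strict_mono (\<rho> :: nat \<Rightarrow> nat)" "(u \<circ> \<rho>) \<longlonglongrightarrow> z"
    using compact_sphere[of "0::'a" 1] u unfolding compact_def by metis
  have to0: "(\<lambda>k. inverse (real (Suc (\<rho> k)))) \<longlonglongrightarrow> 0"
    using LIMSEQ_subseq_LIMSEQ[OF LIMSEQ_inverse_real_of_nat \<rho>(1)] by (simp add: o_def)
  have "(\<lambda>k. u (\<rho> k) - w (\<rho> k)) \<longlonglongrightarrow> 0"
    by (rule Lim_null_comparison[OF _ to0]) (use uw in auto)
  from tendsto_diff[OF \<rho>(2) this] have wz: "(\<lambda>k. w (\<rho> k)) \<longlonglongrightarrow> z"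
    by (simp add: o_def)
  \<comment> \<open>The rescaled vectors \<open>w\<close> lie in \<open>V\<close> and share the
    limit of the directions \<open>u\<close>; \<open>V\<close> is closed.\<close>
  have "z \<in> V"
    by (rule closed_sequentially[OF closed_subspace[OF V] _ wz]) (rule w)
  obtain K where "K > 0" and K: "\<And>x y. x \<in> V \<Longrightarrow> y \<in> V \<Longrightarrow> norm (L x - L y) \<le> K * norm (x - y)"
    using linear_maps_Lipschitz[OF L V] by blast
  obtain \<delta> \<theta> where "\<delta> > 0" "\<theta> > 0" and dir': "\<And>x. \<lbrakk>x \<in> A - {a}; norm (x - a) \<le> \<delta>;
      norm ((x - a) /\<^sub>R norm (x - a) - z) \<le> \<theta>\<rbrakk> \<Longrightarrow>
      norm (f x - f a - norm (x - a) *\<^sub>R L z) \<le> \<epsilon> / 2 * norm (x - a)"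
    using dir[OF \<open>z \<in> V\<close>, unfolded approximable_in_direction_def, rule_format, of "\<epsilon> / 2"] \<open>\<epsilon> > 0\<close> z
    by auto
  have "\<forall>\<^sub>F k in sequentially. inverse (real (Suc (\<rho> k))) < \<delta>"
    using to0 \<open>\<delta> > 0\<close> by (rule order_tendstoD)
  moreover have "\<forall>\<^sub>F k in sequentially. dist (u (\<rho> k)) z < \<theta>"
    using tendstoD[OF \<rho>(2) \<open>\<theta> > 0\<close>] by simp
  \<comment> \<open>By the Lipschitz bound, replacing \<open>L (w m)\<close> by \<open>L z\<close>
    costs at most \<open>\<epsilon> / 2\<close>; the directional limit takes the other half.\<close>
  moreover have "\<forall>\<^sub>F k in sequentially. dist (w (\<rho> k)) z < \<epsilon> / (2 * K)"
    using tendstoD[OF wz, of "\<epsilon> / (2 * K)"] \<open>K > 0\<close> \<open>\<epsilon> > 0\<close> by simp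
  ultimately have "\<forall>\<^sub>F k in sequentially. False"
  proof eventually_elim
    case (elim k)
    define m where "m = \<rho> k"
    have "norm (x m - a) \<le> \<delta>" "norm ((x m - a) /\<^sub>R norm (x m - a) - z) \<le> \<theta>"
      using elim xv(3)[of m] by (auto simp: m_def u_def dist_norm)
    then have 1: "norm (f (x m) - f a - n m *\<^sub>R L z) \<le> \<epsilon> / 2 * n m"
      using dir'[of "x m"] xv(1) n[of m] by (simp add: n_def)
    have "norm (L (w m) - L z) \<le> K * norm (w m - z)" using K w \<open>z \<in> V\<close> by blast
    also have "\<dots> \<le> \<epsilon> / 2"
      using elim(3) \<open>K > 0\<close> by (simp add: m_def dist_norm field_simps)
    finally have 2: "n m * norm (L (w m) - L z) \<le> n m * (\<epsilon> / 2)"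
      using n[of m] by simp
    have "f (x m) - f a - L (v m) = (f (x m) - f a - n m *\<^sub>R L z) - n m *\<^sub>R (L (w m) - L z)"
      using linear_maps_scaleR[OF L w, of "n m"] by (simp add: v_eq algebra_simps)
    then have "norm (f (x m) - f a - L (v m)) \<le>
        norm (f (x m) - f a - n m *\<^sub>R L z) + norm (n m *\<^sub>R (L (w m) - L z))"
      by (metis norm_triangle_ineq4)
    also have "\<dots> \<le> \<epsilon> / 2 * n m + n m * (\<epsilon> / 2)"
      unfolding norm_scaleR abs_of_pos[OF n] using 1 2 by (rule add_mono)
    finally show False using xv(5)[of m] by (simp add: n_def)
  qed
  then show False by simp
qed

section \<open>The equivalences\<close>

theorem proposition4p1:
  fixes A :: "(real ^ 'm) set" and a :: "real ^ 'm" and f :: "real ^ 'm \<Rightarrow> real ^ 'n"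
    and V :: "(real ^ 'm) set" and L :: "real ^ 'm \<Rightarrow> real ^ 'n"
  assumes "a \<in> A" and "subspace V" and "L \<in> linear_maps V"
  shows
    "(tangential_derivative f A a V L \<longleftrightarrow>
        (\<forall>W U \<psi>. diffeomorphism_on W \<psi> \<and> U \<subseteq> W \<and> U \<subseteq> A \<and> openin (top_of_set A) U \<and> a \<in> U \<longrightarrow>
           transported_directional_derivative f a V L W U \<psi>))
     \<and>
     (tangential_derivative f A a V L \<longleftrightarrow>
        (\<forall>\<gamma> :: real \<Rightarrow> real ^ 'm.
           \<gamma> C1_differentiable_on {-1<..<1} \<and> \<gamma> 0 = a \<and> vector_derivative \<gamma> (at 0) \<in> V - {0} \<longrightarrow>
           ((f \<circ> \<gamma>) has_vector_derivative L (vector_derivative \<gamma> (at 0)))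
             (at 0 within {t \<in> {-1<..<1}. \<gamma> t \<in> A})))
     \<and>
     (tangential_derivative f A a V L \<longleftrightarrow>
        (\<forall>v \<in> V - {0}. \<forall>\<epsilon>>0. \<exists>\<delta>>0. \<exists>\<theta>>0. \<forall>x \<in> A - {a}.
           norm (x - a) \<le> \<delta> \<and> norm ((x - a) /\<^sub>R norm (x - a) - v) \<le> \<theta> \<longrightarrow>
           norm (f x - f a - norm (x - a) *\<^sub>R L v) \<le> \<epsilon> * norm (x - a)))"
    (is "(?i \<longleftrightarrow> ?ii) \<and> (?i \<longleftrightarrow> ?iii) \<and> (?i \<longleftrightarrow> ?iv)")
proof -
  note V = \<open>subspace V\<close> and L = \<open>L \<in> linear_maps V\<close>
  have iv: "?iv \<longleftrightarrow> (\<forall>v \<in> V - {0}. approximable_in_direction f A a v (L v))"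
    unfolding approximable_in_direction_def ..
  \<comment> \<open>The return from (ii) and from (iii) to (i) goes through the cone estimate for
    unit vectors.\<close>
  have cones: ?i if "\<And>v. v \<in> V \<Longrightarrow> norm v = 1 \<Longrightarrow> approximable_in_cones f A a v (L v)"
    using approximable_in_direction_imp_tangential[OF L V] approximable_in_cones_imp_direction that
    by blast
  have "?i \<Longrightarrow> ?ii"
    using tangential_imp_transported_directional_derivative[OF _ V] by blast
  moreover have ?i if ?ii
  proof (rule cones, rule transported_imp_approximable_in_cones[OF \<open>a \<in> A\<close> L V])
    \<comment> \<open>The shears are global, so the instance with \<open>W = UNIV\<close> and
      \<open>U = A\<close> is the one to use.\<close>
    show "transported_directional_derivative f a V L UNIV A \<psi>" if "diffeomorphism_on UNIV \<psi>" for \<psi>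
      using \<open>?ii\<close> that \<open>a \<in> A\<close> by auto
  qed
  moreover have ?iii if ?i
  proof (intro allI impI)
    fix \<gamma> :: "real \<Rightarrow> real ^ 'm"
    assume \<gamma>: "\<gamma> C1_differentiable_on {-1<..<1} \<and> \<gamma> 0 = a \<and> vector_derivative \<gamma> (at 0) \<in> V - {0}"
    then have "(\<gamma> has_vector_derivative vector_derivative \<gamma> (at 0)) (at 0)"
      unfolding C1_differentiable_on_eq vector_derivative_works[symmetric] by simp
    then show "((f \<circ> \<gamma>) has_vector_derivative L (vector_derivative \<gamma> (at 0)))
             (at 0 within {t \<in> {-1<..<1}. \<gamma> t \<in> A})"
      by (rule tangential_imp_path_derivative[OF that V]) (use \<gamma> in auto)
  qed
  moreover have ?i if ?iii
  proof (rule cones, rule path_derivative_imp_approximable_in_cones)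
    fix v and \<gamma> :: "real \<Rightarrow> real ^ 'm"
    assume "v \<in> V" "norm v = 1" "\<gamma> C1_differentiable_on {-1<..<1}" "\<gamma> 0 = a"
      "vector_derivative \<gamma> (at 0) = v"
    then show "((f \<circ> \<gamma>) has_vector_derivative L v) (at 0 within {t \<in> {-1<..<1}. \<gamma> t \<in> A})"
      using \<open>?iii\<close> by fastforce
  qed
  moreover have "?i \<Longrightarrow> ?iv"
    unfolding iv using tangential_imp_approximable_in_direction[OF _ V] by blast
  moreover have "?iv \<Longrightarrow> ?i"
    unfolding iv using approximable_in_direction_imp_tangential[OF L V] by fastforce
  ultimately show ?thesis by argo
qed

end
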